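(* Let $r,c\ge 1$ and $m\ge 0$ be integers. If $T(r,c,m)>0$, then $m\equiv rc \pmod 2$ and $m\le\max(r+1,c+1)$.
   Context: A tatami tiling of the $r\times c$ rectangular grid (with $r$ rows and $c$ columns of unit squares) is a tiling of the grid by monomers ($1\times 1$ tiles) and dimers ($1\times 2$ or $2\times 1$ tiles, horizontal or vertical) such that no point is a corner of four distinct tiles. $T(r,c,m)$ denotes the number of tatami tilings of the $r\times c$ grid that use exactly $m$ monomers. *)

theory Defs
  imports Main
begin

definition grid_cells :: "nat \<Rightarrow> nat \<Rightarrow> (nat \<times> nat) set" where
  "grid_cells r c = {0..<r} \<times> {0..<c}"

definition is_monomer :: "(nat \<times> nat) set \<Rightarrow> bool" where
  "is_monomer t \<longleftrightarrow> (\<exists>i j. t = {(i, j)})"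

definition is_dimer :: "(nat \<times> nat) set \<Rightarrow> bool" where
  "is_dimer t \<longleftrightarrow> (\<exists>i j. t = {(i, j), (Suc i, j)} \<or> t = {(i, j), (i, Suc j)})"

definition is_tiling :: "nat \<Rightarrow> nat \<Rightarrow> (nat \<times> nat) set set \<Rightarrow> bool" where
  "is_tiling r c P \<longleftrightarrow>
     (\<forall>t\<in>P. (is_monomer t \<or> is_dimer t) \<and> t \<subseteq> grid_cells r c) \<and>
     (\<forall>x\<in>grid_cells r c. \<exists>!t. t \<in> P \<and> x \<in> t)"

text \<open>Tatami condition: no grid point is a corner of four distinct tiles.  Only interior
  grid points (i,j), 0<i<r, 0<j<c, can be corners of four tiles; the four cells
  around such a point are (i-1,j-1),(i-1,j),(i,j-1),(i,j).\<close>
definition is_tatami :: "nat \<Rightarrow> nat \<Rightarrow> (nat \<times> nat) set set \<Rightarrow> bool" where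
  "is_tatami r c P \<longleftrightarrow> is_tiling r c P \<and>
     (\<forall>i j. 0 < i \<and> i < r \<and> 0 < j \<and> j < c \<longrightarrow>
        \<not> (\<exists>t1\<in>P. \<exists>t2\<in>P. \<exists>t3\<in>P. \<exists>t4\<in>P.
              (i - 1, j - 1) \<in> t1 \<and> (i - 1, j) \<in> t2 \<and> (i, j - 1) \<in> t3 \<and> (i, j) \<in> t4 \<and>
              t1 \<noteq> t2 \<and> t1 \<noteq> t3 \<and> t1 \<noteq> t4 \<and> t2 \<noteq> t3 \<and> t2 \<noteq> t4 \<and> t3 \<noteq> t4))"

definition num_monomers :: "(nat \<times> nat) set set \<Rightarrow> nat" where
  "num_monomers P = card {t \<in> P. is_monomer t}"

definition T :: "nat \<Rightarrow> nat \<Rightarrow> nat \<Rightarrow> nat" where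
  "T r c m = card {P. is_tatami r c P \<and> num_monomers P = m}"

end

theory Submission
  imports Defs
begin

text \<open>Represent each dimer by the unit lattice edge between its two cells.  In a tatami tiling every
  cell has at most one side among these edges and every interior point is an end of at least one,
  so the restriction to a subrectangle has the same property.  The proof bounds the number \<open>N\<close> of
  edges from below by \<open>2 N \<ge> c (r - 1) - 1\<close> for \<open>r \<le> c\<close>, inductively removing outer columns and
  rows.  The edges lost with a column are those counted by \<open>line_sum\<close> on the line that becomes the
  new border.  Adding the point conditions on this line and subtracting the cell conditions on the
  next column shows that the count drops by at least one when passing to the next line, shortened at
  both ends; so a line of length \<open>n\<close> has count at least \<open>(n - 1) div 2\<close>.  Only squares and even \<open>r\<close>
  need an improvement by one.\<close>

section \<open>Line sums on integer intervals\<close>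

text \<open>In the main use \<open>l\<close> is \<open>R\<close> on an outer column and
  \<open>d\<close> is \<open>D\<close> on the inner side of that column. The first sum starts at
  \<open>p+1\<close> because edges on the border of a rectangle are not counted.\<close>

definition line_sum :: "(int \<Rightarrow> int) \<Rightarrow> (int \<Rightarrow> int) \<Rightarrow> int \<Rightarrow> int \<Rightarrow> int" where
  "line_sum l d p q = (\<Sum>y\<in>{p+1..<q}. l y) + (\<Sum>y\<in>{p..<q}. d y)"

lemma sum_int_first: "p < q \<Longrightarrow> sum f {p..<q} = f p + sum f {p+1..<q}" for p q :: int and f :: "int \<Rightarrow> int"
proof -
  assume "p < q"
  then have "{p..<q} = insert p {p+1..<q}" by auto
  then show ?thesis by simp
qed

lemma sum_int_last: "p < q \<Longrightarrow> sum f {p..<q} = sum f {p..<q-1} + f (q-1)" for p q :: int and f :: "int \<Rightarrow> int"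
proof -
  assume "p < q"
  then have "{p..<q} = insert (q-1) {p..<q-1}" by auto
  then show ?thesis by simp
qed

lemma sum_int_shift: "(\<Sum>y\<in>{p..<q}. f (y+1)) = sum f {p+1..<q+1}" for p q :: int and f :: "int \<Rightarrow> int"
  by (rule sum.reindex_bij_witness[of _ "\<lambda>y. y-1" "\<lambda>y. y+1"]) auto

lemma line_sum_last:
  "p + 1 < q \<Longrightarrow> line_sum l d p q = line_sum l d p (q-1) + l (q-1) + d (q-1)"
  unfolding line_sum_def using sum_int_last[of p q d] sum_int_last[of "p+1" q l] by simp

lemma line_sum_nonneg:
  "(\<And>y. 0 \<le> l y) \<Longrightarrow> (\<And>y. 0 \<le> d y) \<Longrightarrow> 0 \<le> line_sum l d p q"
  unfolding line_sum_def by (simp add: sum_nonneg)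

text \<open>There are q - p - 1 points and only q - p - 2 cells, whence the gain of one. In the
  difference of the two sums each \<open>l'\<close> term occurs once from the points and, away from
  the ends, twice from the cells, so exactly the range of the shortened line survives with a minus
  sign; likewise \<open>d\<close> survives once on its whole range.\<close>

lemma line_sum_step:
  assumes len: "p + 3 \<le> q"
    and cover: "\<And>y. p < y \<Longrightarrow> y < q \<Longrightarrow> 1 \<le> l y + l' y + d y + d (y-1)"
    and cell: "\<And>y. p < y \<Longrightarrow> y < q-1 \<Longrightarrow> l' y + l' (y+1) + d y + d' y \<le> 1"
  shows "line_sum l' d' (p+1) (q-1) + 1 \<le> line_sum l d p q"
proof -
  have "(\<Sum>y\<in>{p+1..<q}. 1) \<le> (\<Sum>y\<in>{p+1..<q}. l y + l' y + d y + d (y-1))"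
    by (rule sum_mono) (auto intro!: cover)
  moreover have "(\<Sum>y\<in>{p+1..<q-1}. l' y + l' (y+1) + d y + d' y) \<le> (\<Sum>y\<in>{p+1..<q-1}. 1)"
    by (rule sum_mono) (auto intro!: cell)
  moreover have "(\<Sum>y\<in>{p+1..<q}. d (y-1)) = sum d {p..<q-1}"
    using sum_int_shift[of "\<lambda>y. d (y-1)" p "q-1"] by simp
  moreover have "(\<Sum>y\<in>{p+1..<q-1}. l' (y+1)) = sum l' {p+2..<q}"
    using sum_int_shift[of l' "p+1" "q-1"] by (simp add: add.assoc)
  moreover have "sum d {p..<q-1} = d p + sum d {p+1..<q-1}" "sum d {p..<q} = d p + sum d {p+1..<q}"
    "sum l' {p+1..<q} = l' (p+1) + sum l' {p+2..<q}"
    "sum l' {p+1..<q-1} = l' (p+1) + sum l' {p+2..<q-1}"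
    using len by (simp_all add: sum_int_first[of p] sum_int_first[of "p+1"] add.assoc)
  ultimately show ?thesis
    using len by (simp add: line_sum_def sum.distrib add.assoc)
qed

text \<open>The \<open>i\<close>-th application of \<open>line_sum_step\<close>, counted from 0,
  starts from a line of length q - p - 2i. The length hypothesis makes this at least 3 up to i = j -
  1.\<close>

lemma line_sum_iterate:
  assumes "p + 2 * int j + 1 \<le> q"
    and "\<And>i y. i < j \<Longrightarrow> p < y \<Longrightarrow> y < q \<Longrightarrow> 1 \<le> l i y + l (Suc i) y + d i y + d i (y-1)"
    and "\<And>i y. i < j \<Longrightarrow> p < y \<Longrightarrow> y < q-1 \<Longrightarrow>
           l (Suc i) y + l (Suc i) (y+1) + d i y + d (Suc i) y \<le> 1"
  shows "int j + line_sum (l j) (d j) (p + int j) (q - int j) \<le> line_sum (l 0) (d 0) p q"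
  using assms
proof (induction j)
  case (Suc j)
  have "line_sum (l (Suc j)) (d (Suc j)) (p + int j + 1) (q - int j - 1) + 1
      \<le> line_sum (l j) (d j) (p + int j) (q - int j)"
    using Suc.prems by (intro line_sum_step) auto
  moreover have "int j + line_sum (l j) (d j) (p + int j) (q - int j) \<le> line_sum (l 0) (d 0) p q"
    using Suc by force
  ultimately show ?case by (simp add: algebra_simps)
qed simp

section \<open>Lattice edges in a rectangle\<close>

text \<open>A dimer is encoded by the unit edge of the point lattice that separates its two cells:
  \<open>R x y\<close> is the multiplicity (0 or 1) of the edge from \<open>(x, y)\<close> to \<open>(x+1, y)\<close>, and \<open>D x y\<close> that
  of the edge from \<open>(x, y)\<close> to \<open>(x, y+1)\<close>.  Disjointness of the tiles bounds the sum over the four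
  sides of a cell; the tatami condition says that every interior point is an endpoint of an edge.\<close>

definition tatami_edges ::
    "int \<Rightarrow> int \<Rightarrow> int \<Rightarrow> int \<Rightarrow> (int \<Rightarrow> int \<Rightarrow> int) \<Rightarrow> (int \<Rightarrow> int \<Rightarrow> int) \<Rightarrow> bool" where
  "tatami_edges a b p q R D \<longleftrightarrow>
     (\<forall>x y. 0 \<le> R x y \<and> 0 \<le> D x y) \<and>
     (\<forall>x y. a \<le> x \<and> x < b \<and> p \<le> y \<and> y < q \<longrightarrow> R x y + R x (y+1) + D x y + D (x+1) y \<le> 1) \<and>
     (\<forall>x y. a < x \<and> x < b \<and> p < y \<and> y < q \<longrightarrow> 1 \<le> R x y + R (x-1) y + D x y + D x (y-1))"

text \<open>Border edges are left out. In a subrectangle they may be present, as traces of dimers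
  cut by the border; they still enter the cell conditions.\<close>

definition edge_count ::
    "int \<Rightarrow> int \<Rightarrow> int \<Rightarrow> int \<Rightarrow> (int \<Rightarrow> int \<Rightarrow> int) \<Rightarrow> (int \<Rightarrow> int \<Rightarrow> int) \<Rightarrow> int" where
  "edge_count a b p q R D =
     (\<Sum>x\<in>{a..<b}. \<Sum>y\<in>{p+1..<q}. R x y) + (\<Sum>x\<in>{a+1..<b}. \<Sum>y\<in>{p..<q}. D x y)"

lemma tatami_edges_nonneg:
  "tatami_edges a b p q R D \<Longrightarrow> 0 \<le> R x y" "tatami_edges a b p q R D \<Longrightarrow> 0 \<le> D x y"
  unfolding tatami_edges_def by blast+

lemma tatami_edges_cell:
  "tatami_edges a b p q R D \<Longrightarrow> a \<le> x \<Longrightarrow> x < b \<Longrightarrow> p \<le> y \<Longrightarrow> y < q \<Longrightarrow>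
     R x y + R x (y+1) + D x y + D (x+1) y \<le> 1"
  unfolding tatami_edges_def by blast

lemma tatami_edges_cover:
  "tatami_edges a b p q R D \<Longrightarrow> a < x \<Longrightarrow> x < b \<Longrightarrow> p < y \<Longrightarrow> y < q \<Longrightarrow>
     1 \<le> R x y + R (x-1) y + D x y + D x (y-1)"
  unfolding tatami_edges_def by blast

lemma tatami_edges_subrect:
  "tatami_edges a b p q R D \<Longrightarrow> a \<le> a' \<Longrightarrow> b' \<le> b \<Longrightarrow> p \<le> p' \<Longrightarrow> q' \<le> q \<Longrightarrow>
     tatami_edges a' b' p' q' R D"
  unfolding tatami_edges_def by force

lemma tatami_edges_transpose:
  "tatami_edges a b p q R D \<Longrightarrow> tatami_edges p q a b (\<lambda>x y. D y x) (\<lambda>x y. R y x)"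
  unfolding tatami_edges_def by (simp add: algebra_simps)

lemma edge_count_transpose:
  "edge_count p q a b (\<lambda>x y. D y x) (\<lambda>x y. R y x) = edge_count a b p q R D"
  unfolding edge_count_def
  by (subst (1 2) sum.swap) simp

lemma edge_count_nonneg: "tatami_edges a b p q R D \<Longrightarrow> 0 \<le> edge_count a b p q R D"
  unfolding edge_count_def tatami_edges_def by (simp add: sum_nonneg)

lemma edge_count_left:
  "a + 1 < b \<Longrightarrow>
     edge_count a b p q R D = edge_count (a+1) b p q R D + line_sum (R a) (D (a+1)) p q"
  unfolding edge_count_def line_sum_def by (simp add: sum_int_first[of a] sum_int_first[of "a+1"])

lemma edge_count_right:
  "a + 1 < b \<Longrightarrow>
     edge_count a b p q R D = edge_count a (b-1) p q R D + line_sum (R (b-1)) (D (b-1)) p q"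
  unfolding edge_count_def line_sum_def by (simp add: sum_int_last[of a] sum_int_last[of "a+1"])

lemma edge_count_top:
  "p + 1 < q \<Longrightarrow> edge_count a b p q R D
     = edge_count a b (p+1) q R D + line_sum (\<lambda>x. D x p) (\<lambda>x. R x (p+1)) a b"
  using edge_count_left[of p q a b "\<lambda>x y. D y x" "\<lambda>x y. R y x"]
  unfolding edge_count_transpose[where R = R and D = D] .

section \<open>Lower bounds for border lines\<close>

text \<open>The conditions used belong to the lines x = a+1, ..., a+j, on ranges that shrink at both
  ends: a triangle or trapezoid over the left side. The bound on \<open>j\<close> against the width
  keeps these lines in the interior.\<close>

lemma left_line_iterate:
  assumes "tatami_edges a b p q R D" and "p + 2 * int j + 1 \<le> q" and "int j < b - a"
  shows "int j + line_sum (R (a + int j)) (D (a + 1 + int j)) (p + int j) (q - int j)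
      \<le> line_sum (R a) (D (a+1)) p q"
proof -
  have "1 \<le> R (a + int i) y + R (a + int (Suc i)) y + D (a + 1 + int i) y + D (a + 1 + int i) (y-1)"
    if "i < j" "p < y" "y < q" for i y
  proof -
    have "1 \<le> R (a+1+int i) y + R (a+1+int i-1) y + D (a+1+int i) y + D (a+1+int i) (y-1)"
      using assms that by (intro tatami_edges_cover[OF assms(1)]) auto
    then show ?thesis by (simp add: algebra_simps)
  qed
  moreover have "R (a + int (Suc i)) y + R (a + int (Suc i)) (y+1)
      + D (a + 1 + int i) y + D (a + 1 + int (Suc i)) y \<le> 1"
    if "i < j" "p < y" "y < q - 1" for i y
  proof -
    have "R (a+1+int i) y + R (a+1+int i) (y+1) + D (a+1+int i) y + D (a+1+int i+1) y \<le> 1"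
      using assms that by (intro tatami_edges_cell[OF assms(1)]) auto
    then show ?thesis by (simp add: algebra_simps)
  qed
  ultimately show ?thesis
    using line_sum_iterate[OF assms(2), of "\<lambda>i. R (a + int i)" "\<lambda>i. D (a + 1 + int i)"] by simp
qed

text \<open>Mirror image of the left side. Both indices are now b - 1 - i, since the inner side of
  column b - 1 is the line x = b - 1; the cells used lie one column further in.\<close>

lemma right_line_iterate:
  assumes "tatami_edges a b p q R D" and "p + 2 * int j + 1 \<le> q" and "int j < b - a"
  shows "int j + line_sum (R (b - 1 - int j)) (D (b - 1 - int j)) (p + int j) (q - int j)
      \<le> line_sum (R (b-1)) (D (b-1)) p q"
proof -
  have "1 \<le> R (b-1-int i) y + R (b-1-int (Suc i)) y + D (b-1-int i) y + D (b-1-int i) (y-1)"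
    if "i < j" "p < y" "y < q" for i y
  proof -
    have "1 \<le> R (b-1-int i) y + R (b-1-int i-1) y + D (b-1-int i) y + D (b-1-int i) (y-1)"
      using assms that by (intro tatami_edges_cover[OF assms(1)]) auto
    then show ?thesis by (simp add: algebra_simps)
  qed
  moreover have "R (b-1-int (Suc i)) y + R (b-1-int (Suc i)) (y+1)
      + D (b-1-int i) y + D (b-1-int (Suc i)) y \<le> 1"
    if "i < j" "p < y" "y < q - 1" for i y
  proof -
    have "R (b-2-int i) y + R (b-2-int i) (y+1) + D (b-2-int i) y + D (b-2-int i+1) y \<le> 1"
      using assms that by (intro tatami_edges_cell[OF assms(1)]) auto
    then show ?thesis by (simp add: algebra_simps)
  qed
  ultimately show ?thesis
    using line_sum_iterate[OF assms(2), of "\<lambda>i. R (b-1-int i)" "\<lambda>i. D (b-1-int i)"] by simp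
qed

lemma left_line_ge:
  assumes "tatami_edges a b p q R D" and "p + 2 * int j + 1 \<le> q" and "int j < b - a"
  shows "int j \<le> line_sum (R a) (D (a+1)) p q"
  using left_line_iterate[OF assms] line_sum_nonneg[of "R (a + int j)" "D (a + 1 + int j)" "p + int j" "q - int j"] assms(1)
  unfolding tatami_edges_def by simp

lemma right_line_ge:
  assumes "tatami_edges a b p q R D" and "p + 2 * int j + 1 \<le> q" and "int j < b - a"
  shows "int j \<le> line_sum (R (b-1)) (D (b-1)) p q"
  using right_line_iterate[OF assms] line_sum_nonneg[of "R (b - 1 - int j)" "D (b - 1 - int j)" "p + int j" "q - int j"] assms(1)
  unfolding tatami_edges_def by simp

lemma top_line_ge:
  assumes "tatami_edges a b p q R D" and "a + 2 * int j + 1 \<le> b" and "int j < q - p"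
  shows "int j \<le> line_sum (\<lambda>x. D x p) (\<lambda>x. R x (p+1)) a b"
  using left_line_ge[OF tatami_edges_transpose[OF assms(1)] assms(2,3)] .

lemma line_sum_two:
  assumes "q = p + 2"
  shows "line_sum l d p q = l (p+1) + d p + d (p+1)"
proof -
  have "{p+1..<q} = {p+1}" "{p..<q} = {p,p+1}" using assms by auto
  then show ?thesis by (simp add: line_sum_def)
qed

text \<open>For even height 2k each line alone is only known to be at least k - 1. The missing one
  comes from the fact that if the first line attains k - 1, then the second is at least k.\<close>

lemma two_left_lines_ge:
  assumes t: "tatami_edges a b p q R D" and k: "1 \<le> k" and q: "q = p + 2 * int k" and b: "a + q - p < b"
  shows "2 * int k - 1 \<le> line_sum (R a) (D (a+1)) p q + line_sum (R (a+1)) (D (a+2)) p q"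
proof -
  let ?L = "line_sum (R a) (D (a+1))" and ?L' = "line_sum (R (a+1)) (D (a+2))"
  obtain j where j: "k = Suc j" using k by (cases k) auto
  have t': "tatami_edges (a+1) b p q R D" and t'': "tatami_edges (a+1) b (p+1) q R D"
    using t by (auto elim: tatami_edges_subrect)
  have nn: "\<And>x y. 0 \<le> R x y" "\<And>x y. 0 \<le> D x y" using t by (auto intro: tatami_edges_nonneg)
  have A: "int j \<le> ?L p q" using t q b j by (intro left_line_ge) auto
  have A': "int j \<le> ?L' p q" using left_line_ge[OF t', of j] q b j by (simp add: add.assoc)
  have B: "int j \<le> ?L' (p+1) q" using left_line_ge[OF t'', of j] q b j by (simp add: add.assoc)
  have C: "int j \<le> ?L' p (q-1)"
    using left_line_ge[OF tatami_edges_subrect[OF t', of "a+1" b p "q-1"], of j] q b j by (simp add: add.assoc)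
  show ?thesis
  proof (cases "int k \<le> ?L p q")
    case True
    then show ?thesis using A' j by simp
  next
    case False
    then have L: "?L p q = int j" using A j by simp
    have "int k \<le> ?L' p q"
    proof (cases j)
      case 0
      then have q2: "q = p + 2" using j q by simp
      \<comment> \<open>Height 2: the first line is empty, so the point on it can only be covered by
        the edge leading into the next column.\<close>
      have "1 \<le> R (a+1) (p+1) + R (a+1-1) (p+1) + D (a+1) (p+1) + D (a+1) (p+1-1)"
        using b q2 by (intro tatami_edges_cover[OF t]) auto
      moreover have "R a (p+1) + D (a+1) p + D (a+1) (p+1) = 0"
        using L 0 by (simp add: line_sum_two[OF q2])
      ultimately have "1 \<le> R (a+1) (p+1)" by simp
      then show ?thesis using nn j 0 by (simp add: line_sum_two[OF q2] add_increasing2)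
    next
      case (Suc i)
      \<comment> \<open>The second line, shortened at both ends, is below j. By \<open>B\<close>,
        restoring the end at q brings it to at least j, so the terms at q - 1 contribute at least
        one; adding them to \<open>C\<close> gives j + 1 = k.\<close>
      have "int 1 + ?L' (p+1) (q-1) \<le> ?L p q"
        using left_line_iterate[OF t, of 1] q b j Suc by (simp add: add.assoc)
      then have "?L' (p+1) (q-1) < int j" using L by simp
      moreover have "?L' (p+1) q = ?L' (p+1) (q-1) + R (a+1) (q-1) + D (a+2) (q-1)"
        "?L' p q = ?L' p (q-1) + R (a+1) (q-1) + D (a+2) (q-1)"
        using q j Suc by (intro line_sum_last; simp)+
      ultimately show ?thesis using B C j by linarith
    qed
    then show ?thesis using L j by simp
  qed
qed

text \<open>The triangles over the left and the right side meet in the central point, and an edge at this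
  point counts for at least one of the two sides.\<close>

lemma opposite_lines_even_square_ge:
  assumes t: "tatami_edges a b p q R D" and k: "1 \<le> k"
    and q: "q = p + 2 * int k" and b: "b = a + 2 * int k"
  shows "2 * int k - 1 \<le> line_sum (R a) (D (a+1)) p q + line_sum (R (b-1)) (D (b-1)) p q"
proof -
  obtain j where j: "k = Suc j" using k by (cases k) auto
  let ?x = "a + 1 + int j" and ?y = "p + 1 + int j"
  have x: "b - 1 - int j = ?x" "a + int j = ?x - 1" and y: "p + int j = ?y - 1" "q - int j = ?y - 1 + 2"
    using q b j by auto
  have "int j + line_sum (R (?x-1)) (D ?x) (?y-1) (?y-1+2) \<le> line_sum (R a) (D (a+1)) p q"
    using left_line_iterate[OF t, of j] q b j unfolding x y by simp
  moreover have "int j + line_sum (R ?x) (D ?x) (?y-1) (?y-1+2) \<le> line_sum (R (b-1)) (D (b-1)) p q"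
    using right_line_iterate[OF t, of j] q b j unfolding x y by simp
  moreover have "1 \<le> R ?x ?y + R (?x-1) ?y + D ?x ?y + D ?x (?y-1)"
    using q b j by (intro tatami_edges_cover[OF t]) auto
  moreover have "0 \<le> D ?x ?y" "0 \<le> D ?x (?y-1)" using t by (auto intro: tatami_edges_nonneg)
  ultimately show ?thesis using j unfolding line_sum_two[OF refl] by (simp add: algebra_simps)
qed

section \<open>Lower bound for the number of edges\<close>

text \<open>Since c(r - 1) - 1 = rc - (c + 1), this leaves at most c + 1 cells outside the dimers.
  Induction on c + r suits both the removal of rows or columns and the exchange of the two
  directions.\<close>

lemma edge_count_ge:
  assumes "tatami_edges a b p q R D" and "1 \<le> r" and "r \<le> c"
    and "b = a + int c" and "q = p + int r"
  shows "int c * (int r - 1) - 1 \<le> 2 * edge_count a b p q R D"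
  using assms
proof (induction "c + r" arbitrary: a b p q R D c r rule: less_induct)
  case less
  note t = less.prems(1) and r1 = less.prems(2) and rc = less.prems(3)
    and b = less.prems(4) and q = less.prems(5)
  let ?N = "\<lambda>a b. edge_count a b p q R D"
  have IH: "int c' * (int r' - 1) - 1 \<le> 2 * edge_count a' b' p' q' R' D'"
    if "c' + r' < c + r" "tatami_edges a' b' p' q' R' D'" "1 \<le> r'" "r' \<le> c'"
      "b' = a' + int c'" "q' = p' + int r'" for a' b' p' q' R' D' c' r'
    using less.hyps that by blast
  have sub: "tatami_edges a' b' p' q' R D" if "a \<le> a'" "b' \<le> b" "p \<le> p'" "q' \<le> q" for a' b' p' q'
    using tatami_edges_subrect[OF t] that by blast
  show ?case
  proof (cases "r = 1")
    case True
    then show ?thesis using edge_count_nonneg[OF t] by simp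
  next
    case r2: False
    obtain k where k: "r = 2*k \<or> r = 2*k+1" by (metis oddE evenE)
    then have k1: "1 \<le> k" using r1 r2 by auto
    have "r + 2 \<le> c \<and> r < c \<or> c = r + 1 \<and> r < c \<or> c = r" using rc by linarith
    with k k1 consider "r = 2*k+1" "1 \<le> k" "r < c" | "r = 2*k" "1 \<le> k" "r + 2 \<le> c"
      | "r = 2*k" "1 \<le> k" "c = r + 1" | "r = 2*k" "1 \<le> k" "c = r" | "r = 2*k+1" "1 \<le> k" "c = r"
      by blast
    then show ?thesis
    proof cases
      case 1
      \<comment> \<open>Odd r < c: one removed column carries at least k = (r - 1)/2 edges, exactly
        the required increment.\<close>
      have "int (c-1) * (int r - 1) - 1 \<le> 2 * ?N (a+1) b"
        using IH[OF _ sub, of "c-1" r "a+1" b p q] 1 b q by auto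
      then have "(int c - 1) * (2 * int k) - 1 \<le> 2 * ?N (a+1) b" using 1 by simp
      then have "(int c - 1) * int k \<le> ?N (a+1) b" by (simp add: algebra_simps)
      moreover have "int k \<le> line_sum (R a) (D (a+1)) p q" using t 1 b q by (intro left_line_ge) auto
      ultimately have "int c * int k \<le> ?N a b"
        using edge_count_left[of a b p q R D] 1 b by (simp add: algebra_simps)
      then show ?thesis using 1 by (simp add: algebra_simps)
    next
      case 2
      \<comment> \<open>Even r with c at least r + 2: two columns are removed together, as the
        average loss (r - 1)/2 per column is not an integer.\<close>
      have "int (c-2) * (int r - 1) - 1 \<le> 2 * ?N (a+2) b"
        using IH[OF _ sub, of "c-2" r "a+2" b p q] 2 b q by auto
      then have "(int c - 2) * (int r - 1) - 1 \<le> 2 * ?N (a+2) b" using 2 by simp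
      moreover have "int r - 1 \<le> line_sum (R a) (D (a+1)) p q + line_sum (R (a+1)) (D (a+2)) p q"
        using two_left_lines_ge[OF t, of k] 2 b q by simp
      ultimately show ?thesis
        using edge_count_left[of a b p q R D] edge_count_left[of "a+1" b p q R D] 2 b
        by (simp add: algebra_simps)
    next
      case 3
      have "int r * (int r - 1) - 1 \<le> 2 * ?N (a+1) b"
        using IH[OF _ sub, of r r "a+1" b p q] 3 b q by auto
      then have "2 * (int k * (int r - 1)) - 1 \<le> 2 * ?N (a+1) b" using 3 by (simp add: algebra_simps)
      \<comment> \<open>Parity: r(r - 1) is even, so the bound for the square improves by one half.
        This makes up for the removed line being known only to be at least k - 1.\<close>
      then have "int k * (int r - 1) \<le> ?N (a+1) b" by presburger
      moreover have "int (k-1) \<le> line_sum (R a) (D (a+1)) p q" using t 3 b q by (intro left_line_ge) auto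
      ultimately show ?thesis
        using edge_count_left[of a b p q R D] 3 b by (simp add: algebra_simps)
    next
      case 4
      let ?L = "line_sum (R a) (D (a+1)) p q" and ?R = "line_sum (R (b-1)) (D (b-1)) p q"
      \<comment> \<open>Removing a column from the square leaves more rows than columns, so the
        induction hypothesis is applied to the transpose.\<close>
      have narrow: "int r * (int r - 2) - 1 \<le> 2 * ?N a' b'"
        if "a \<le> a'" "b' \<le> b" "b' = a' + int (r-1)" for a' b'
      proof -
        have "tatami_edges p q a' b' (\<lambda>x y. D y x) (\<lambda>x y. R y x)"
          by (rule tatami_edges_transpose, rule sub) (use that in auto)
        then have "int r * (int (r-1) - 1) - 1 \<le> 2 * edge_count p q a' b' (\<lambda>x y. D y x) (\<lambda>x y. R y x)"
          using that 4 q by (intro IH) auto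
        then show ?thesis unfolding edge_count_transpose[where R = R and D = D] using 4 by simp
      qed
      have "2 * int k - 1 \<le> ?L + ?R"
        using opposite_lines_even_square_ge[OF t, of k] 4 b q by simp
      then consider "int k \<le> ?L" | "int k \<le> ?R" by linarith
      then show ?thesis
      proof cases
        case 1
        then show ?thesis
          using narrow[of "a+1" b] edge_count_left[of a b p q R D] 4 b
          by (simp add: algebra_simps)
      next
        case 2
        then show ?thesis
          using narrow[of a "b-1"] edge_count_right[of a b p q R D] 4 b
          by (simp add: algebra_simps)
      qed
    next
      case 5
      let ?T = "line_sum (\<lambda>x. D x p) (\<lambda>x. R x (p+1))"
      \<comment> \<open>Odd square: a column and the first row are removed, leaving an even square
        whose bound is again rounded up by parity. It remains to lose k edges with each of the
        two.\<close>
      have small: "int k * (2 * int k - 1) \<le> edge_count a' b' (p+1) q R D"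
        if "a \<le> a'" "b' \<le> b" "b' = a' + int (r-1)" for a' b'
      proof -
        have "int (r-1) * (int (r-1) - 1) - 1 \<le> 2 * edge_count a' b' (p+1) q R D"
          using IH[OF _ sub, of "r-1" "r-1" a' b' "p+1" q] that 5 b q by auto
        then have "2 * (int k * (2 * int k - 1)) - 1 \<le> 2 * edge_count a' b' (p+1) q R D"
          using 5 by (simp add: algebra_simps)
        then show ?thesis by presburger
      qed
      have L: "int k \<le> line_sum (R a) (D (a+1)) p q" using t 5 b q by (intro left_line_ge) auto
      have R: "int k \<le> line_sum (R (b-1)) (D (b-1)) p q" using t 5 b q by (intro right_line_ge) auto
      have T: "int k \<le> ?T a b" using t 5 b q by (intro top_line_ge) auto
      have T': "int (k-1) \<le> ?T (a+1) (b-1)"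
        using 5 b q by (intro top_line_ge[OF sub, of _ _ _ q]) auto
      have nn: "0 \<le> D (b-1) p" "0 \<le> R (b-1) (p+1)" using t by (auto intro: tatami_edges_nonneg)
      have last: "?T a b = ?T a (b-1) + D (b-1) p + R (b-1) (p+1)"
        "?T (a+1) b = ?T (a+1) (b-1) + D (b-1) p + R (b-1) (p+1)"
        using 5 b by (intro line_sum_last; simp)+
      \<comment> \<open>After a column is gone the row has even length 2k, for which
        \<open>top_line_ge\<close> gives only k - 1. If the terms at b - 1 are positive, they raise
        the bound \<open>T'\<close> to k; if they vanish, dropping the last column keeps the bound
        \<open>T\<close>. This decides which column to remove.\<close>
      have "int k \<le> ?T (a+1) b \<or> int k \<le> ?T a (b-1)"
        using T T' nn last 5(2) by simp linarith
      then show ?thesis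
      proof
        assume "int k \<le> ?T (a+1) b"
        then show ?thesis
          using small[of "a+1" b] L edge_count_left[of a b p q R D]
            edge_count_top[of p q "a+1" b R D] 5 b q by (simp add: algebra_simps)
      next
        assume "int k \<le> ?T a (b-1)"
        then show ?thesis
          using small[of a "b-1"] R edge_count_right[of a b p q R D]
            edge_count_top[of p q a "b-1" R D] 5 b q by (simp add: algebra_simps)
      qed
    qed
  qed
qed

section \<open>From tilings to lattice edges\<close>

text \<open>Cells are (row, column) while edges use (x, y) with x the column, hence the swap; a
  vertical edge stands for a horizontal dimer. The guards matter because \<open>nat\<close>
  truncates: at x = 0 the set would collapse to a single cell and could be a monomer.\<close>

definition vertical_edge :: "(nat \<times> nat) set set \<Rightarrow> int \<Rightarrow> int \<Rightarrow> int" where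
  "vertical_edge P x y = of_bool (1 \<le> x \<and> 0 \<le> y \<and> {(nat y, nat (x-1)), (nat y, nat x)} \<in> P)"

definition horizontal_edge :: "(nat \<times> nat) set set \<Rightarrow> int \<Rightarrow> int \<Rightarrow> int" where
  "horizontal_edge P x y = of_bool (0 \<le> x \<and> 1 \<le> y \<and> {(nat (y-1), nat x), (nat y, nat x)} \<in> P)"

lemma tile_unique:
  assumes til: "is_tiling r c P" and t: "t \<in> P" "t' \<in> P" "z \<in> t" "z \<in> t'"
  shows "t = t'"
proof -
  have "z \<in> grid_cells r c" using til t unfolding is_tiling_def by blast
  then have "\<exists>!t. t \<in> P \<and> z \<in> t" using til unfolding is_tiling_def by blast
  then show ?thesis using t by blast
qed

lemma tile_of_two_cells:
  assumes "is_tiling r c P" "t \<in> P" "u \<in> t" "v \<in> t" "u \<noteq> v"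
  shows "t = {u, v}" and "is_dimer t"
proof -
  have "is_monomer t \<or> is_dimer t" using assms unfolding is_tiling_def by blast
  moreover have "\<not> is_monomer t" using assms unfolding is_monomer_def by auto
  ultimately show "is_dimer t" by blast
  then show "t = {u, v}" using assms unfolding is_dimer_def by fastforce
qed

text \<open>Two edges on the sides of one cell would be two tiles sharing that cell. Around an
  interior point two of the four cells share a tile; it is a dimer on adjacent cells, and its edge
  ends at the point.\<close>

lemma tatami_edges_of_tiling:
  assumes "is_tatami r c P"
  shows "tatami_edges 0 (int c) 0 (int r) (horizontal_edge P) (vertical_edge P)"
  unfolding tatami_edges_def
proof (intro conjI allI impI)
  have til: "is_tiling r c P" using assms unfolding is_tatami_def by blast
  fix x y :: int
  show "0 \<le> horizontal_edge P x y" "0 \<le> vertical_edge P x y"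
    unfolding horizontal_edge_def vertical_edge_def by simp_all
  {
    assume "0 \<le> x \<and> x < int c \<and> 0 \<le> y \<and> y < int r"
    then obtain i j where ij: "y = int i" "x = int j" by (metis zero_le_imp_eq_int)
    let ?a = "{(i - 1, j), (i, j)}" and ?b = "{(i, j), (Suc i, j)}"
      and ?c = "{(i, j - 1), (i, j)}" and ?d = "{(i, j), (i, Suc j)}"
    have nat: "nat (int i + 1) = Suc i" "nat (int j + 1) = Suc j"
      "nat (int i - 1) = i - 1" "nat (int j - 1) = j - 1" by auto
    have uniq: "s = t" if "s \<in> P" "t \<in> P" "(i, j) \<in> s" "(i, j) \<in> t" for s t
      using tile_unique[OF til that] .
    have "\<not> (?a \<in> P \<and> ?b \<in> P)" using uniq[of ?a ?b] by (auto simp: doubleton_eq_iff)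
    \<comment> \<open>For i = j = 0 truncated subtraction turns both sets into the same singleton.
      The guard in \<open>horizontal_edge\<close> takes care of i = 0.\<close>
    moreover have "\<not> (?a \<in> P \<and> ?c \<in> P)" if "1 \<le> i"
      using uniq[of ?a ?c] that by (auto simp: doubleton_eq_iff)
    moreover have "\<not> (?a \<in> P \<and> ?d \<in> P)" using uniq[of ?a ?d] by (auto simp: doubleton_eq_iff)
    moreover have "\<not> (?b \<in> P \<and> ?c \<in> P)" using uniq[of ?b ?c] by (auto simp: doubleton_eq_iff)
    moreover have "\<not> (?b \<in> P \<and> ?d \<in> P)" using uniq[of ?b ?d] by (auto simp: doubleton_eq_iff)
    moreover have "\<not> (?c \<in> P \<and> ?d \<in> P)" using uniq[of ?c ?d] by (auto simp: doubleton_eq_iff)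
    ultimately show "horizontal_edge P x y + horizontal_edge P x (y+1)
        + vertical_edge P x y + vertical_edge P (x+1) y \<le> 1"
      unfolding horizontal_edge_def vertical_edge_def ij by (auto simp: nat)
  }
  {
    assume xy: "0 < x \<and> x < int c \<and> 0 < y \<and> y < int r"
    then have "y = int (Suc (nat (y - 1)))" "x = int (Suc (nat (x - 1)))" by auto
    then obtain i j where ij: "y = int (Suc i)" "x = int (Suc j)" by blast
    let ?z1 = "(i, j)" and ?z2 = "(i, Suc j)" and ?z3 = "(Suc i, j)" and ?z4 = "(Suc i, Suc j)"
    have lt: "Suc i < r" "Suc j < c" using xy ij by auto
    have "\<exists>t\<in>P. z \<in> t" if "z \<in> grid_cells r c" for z
      using til that unfolding is_tiling_def by blast
    then obtain t1 t2 t3 t4 where t: "t1 \<in> P" "?z1 \<in> t1" "t2 \<in> P" "?z2 \<in> t2"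
      "t3 \<in> P" "?z3 \<in> t3" "t4 \<in> P" "?z4 \<in> t4"
      using lt unfolding grid_cells_def by (metis Suc_lessD atLeastLessThan_iff mem_Sigma_iff zero_le)
    have "t1 = t2 \<or> t1 = t3 \<or> t1 = t4 \<or> t2 = t3 \<or> t2 = t4 \<or> t3 = t4"
    proof (rule ccontr)
      assume "\<not> ?thesis"
      with t have "\<exists>t1\<in>P. \<exists>t2\<in>P. \<exists>t3\<in>P. \<exists>t4\<in>P.
          (Suc i - 1, Suc j - 1) \<in> t1 \<and> (Suc i - 1, Suc j) \<in> t2 \<and> (Suc i, Suc j - 1) \<in> t3 \<and> (Suc i, Suc j) \<in> t4 \<and>
          t1 \<noteq> t2 \<and> t1 \<noteq> t3 \<and> t1 \<noteq> t4 \<and> t2 \<noteq> t3 \<and> t2 \<noteq> t4 \<and> t3 \<noteq> t4"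
        by (metis diff_Suc_1)
      then show False using assms lt unfolding is_tatami_def by blast
    qed
    moreover have "t1 \<noteq> t4"
    proof
      assume "t1 = t4"
      then have z: "t1 \<in> P" "?z1 \<in> t1" "?z4 \<in> t1" "?z1 \<noteq> ?z4" using t by simp_all
      have "is_dimer {?z1, ?z4}"
        using tile_of_two_cells[OF til z] by simp
      then show False by (auto simp: is_dimer_def doubleton_eq_iff)
    qed
    moreover have "t2 \<noteq> t3"
    proof
      assume "t2 = t3"
      then have z: "t2 \<in> P" "?z2 \<in> t2" "?z3 \<in> t2" "?z2 \<noteq> ?z3" using t by simp_all
      have "is_dimer {?z2, ?z3}"
        using tile_of_two_cells[OF til z] by simp
      then show False by (auto simp: is_dimer_def doubleton_eq_iff)
    qed
    ultimately consider "t1 = t2" | "t1 = t3" | "t2 = t4" | "t3 = t4" by blast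
    then have "{?z1, ?z2} \<in> P \<or> {?z1, ?z3} \<in> P \<or> {?z2, ?z4} \<in> P \<or> {?z3, ?z4} \<in> P"
    proof cases
      case 1
      then have "t1 = {?z1, ?z2}" using t by (intro tile_of_two_cells(1)[OF til]) auto
      then show ?thesis using t by blast
    next
      case 2
      then have "t1 = {?z1, ?z3}" using t by (intro tile_of_two_cells(1)[OF til]) auto
      then show ?thesis using t by blast
    next
      case 3
      then have "t2 = {?z2, ?z4}" using t by (intro tile_of_two_cells(1)[OF til]) auto
      then show ?thesis using t by blast
    next
      case 4
      then have "t3 = {?z3, ?z4}" using t by (intro tile_of_two_cells(1)[OF til]) auto
      then show ?thesis using t by blast
    qed
    moreover have "horizontal_edge P x y = of_bool ({?z2, ?z4} \<in> P)"
      "horizontal_edge P (x-1) y = of_bool ({?z1, ?z3} \<in> P)"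
      "vertical_edge P x y = of_bool ({?z3, ?z4} \<in> P)"
      "vertical_edge P x (y-1) = of_bool ({?z1, ?z2} \<in> P)"
      unfolding horizontal_edge_def vertical_edge_def ij by (simp_all add: nat_add_distrib)
    ultimately show "1 \<le> horizontal_edge P x y + horizontal_edge P (x-1) y
        + vertical_edge P x y + vertical_edge P x (y-1)"
      by (elim disjE) simp_all
  }
qed

section \<open>Counting tiles\<close>

lemma tiling_finite: "is_tiling r c P \<Longrightarrow> finite P"
proof -
  assume "is_tiling r c P"
  then have "P \<subseteq> Pow (grid_cells r c)" unfolding is_tiling_def by blast
  then show "finite P" by (rule finite_subset) (simp add: grid_cells_def)
qed

text \<open>Counting cells by tiles. This yields the parity claim and turns a lower bound on dimers
  into an upper bound on monomers.\<close>

lemma num_monomers_add_dimers: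
  assumes til: "is_tiling r c P"
  shows "num_monomers P + 2 * card {t \<in> P. is_dimer t} = r * c"
proof -
  have mono: "card t = 1" if "is_monomer t" for t using that unfolding is_monomer_def by auto
  have dim: "card t = 2" if "is_dimer t" for t
    using that unfolding is_dimer_def by (metis Pair_inject card_2_iff n_not_Suc_n)
  have P: "P = {t \<in> P. is_monomer t} \<union> {t \<in> P. is_dimer t}"
    using til unfolding is_tiling_def by blast
  have "\<Union>P = grid_cells r c" using til unfolding is_tiling_def by blast
  then have "r * c = card (\<Union>P)" by (simp add: grid_cells_def)
  also have "\<dots> = sum card P"
  proof (rule card_Union_disjoint)
    show "pairwise disjnt P"
      using tile_unique[OF til] unfolding pairwise_def disjnt_def by blast
    show "finite t" if "t \<in> P" for t
      using til that finite_subset[of t "grid_cells r c"] unfolding is_tiling_def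
      by (simp add: grid_cells_def)
  qed
  also have "\<dots> = sum card {t \<in> P. is_monomer t} + sum card {t \<in> P. is_dimer t}"
    using tiling_finite[OF til] mono dim by (subst P, intro sum.union_disjoint) fastforce+
  also have "\<dots> = num_monomers P + 2 * card {t \<in> P. is_dimer t}"
    by (simp add: num_monomers_def mono dim)
  finally show ?thesis by simp
qed

text \<open>\<open>?f\<close> and \<open>?g\<close> send a counted edge to the dimer it halves. Both
  are injective, and their images are disjoint: the first gives dimers within one column, the second
  dimers within one row.\<close>

lemma edge_count_le_dimers:
  assumes til: "is_tiling r c P"
  shows "edge_count 0 (int c) 0 (int r) (horizontal_edge P) (vertical_edge P)
    \<le> int (card {t \<in> P. is_dimer t})"
proof -
  let ?H = "{(x, y). x \<in> {0..<int c} \<and> y \<in> {1..<int r} \<and> {(nat (y-1), nat x), (nat y, nat x)} \<in> P}"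
  let ?V = "{(x, y). x \<in> {1..<int c} \<and> y \<in> {0..<int r} \<and> {(nat y, nat (x-1)), (nat y, nat x)} \<in> P}"
  let ?f = "\<lambda>(x, y). {(nat (y-1), nat x), (nat y, nat x)}"
  let ?g = "\<lambda>(x, y). {(nat y, nat (x-1)), (nat y, nat x)}"
  have H: "(\<Sum>x\<in>{0..<int c}. \<Sum>y\<in>{1..<int r}. horizontal_edge P x y) = int (card ?H)"
  proof -
    have "(\<Sum>x\<in>{0..<int c}. \<Sum>y\<in>{1..<int r}. horizontal_edge P x y)
        = (\<Sum>z\<in>{0..<int c} \<times> {1..<int r}. of_bool (z \<in> ?H))"
      unfolding sum.cartesian_product by (rule sum.cong) (auto simp: horizontal_edge_def)
    also have "\<dots> = int (card (({0..<int c} \<times> {1..<int r}) \<inter> ?H))" by simp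
    also have "({0..<int c} \<times> {1..<int r}) \<inter> ?H = ?H" by auto
    finally show ?thesis .
  qed
  have V: "(\<Sum>x\<in>{1..<int c}. \<Sum>y\<in>{0..<int r}. vertical_edge P x y) = int (card ?V)"
  proof -
    have "(\<Sum>x\<in>{1..<int c}. \<Sum>y\<in>{0..<int r}. vertical_edge P x y)
        = (\<Sum>z\<in>{1..<int c} \<times> {0..<int r}. of_bool (z \<in> ?V))"
      unfolding sum.cartesian_product by (rule sum.cong) (auto simp: vertical_edge_def)
    also have "\<dots> = int (card (({1..<int c} \<times> {0..<int r}) \<inter> ?V))" by simp
    also have "({1..<int c} \<times> {0..<int r}) \<inter> ?V = ?V" by auto
    finally show ?thesis .
  qed
  have fin: "finite {t \<in> P. is_dimer t}" using tiling_finite[OF til] by simp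
  have sub: "?f ` ?H \<subseteq> {t \<in> P. is_dimer t}" "?g ` ?V \<subseteq> {t \<in> P. is_dimer t}"
  proof -
    have "?f z \<in> {t \<in> P. is_dimer t}" if "z \<in> ?H" for z
    proof -
      obtain x y where z: "z = (x, y)" by force
      then have "nat y = Suc (nat (y-1))" using that by auto
      then show ?thesis using that unfolding is_dimer_def z by auto
    qed
    then show "?f ` ?H \<subseteq> {t \<in> P. is_dimer t}" by (rule image_subsetI)
    have "?g z \<in> {t \<in> P. is_dimer t}" if "z \<in> ?V" for z
    proof -
      obtain x y where z: "z = (x, y)" by force
      then have "nat x = Suc (nat (x-1))" using that by auto
      then show ?thesis using that unfolding is_dimer_def z by auto
    qed
    then show "?g ` ?V \<subseteq> {t \<in> P. is_dimer t}" by (rule image_subsetI)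
  qed
  have "card ?H + card ?V = card (?f ` ?H) + card (?g ` ?V)"
  proof -
    have "inj_on ?f ?H" by (auto simp: inj_on_def doubleton_eq_iff)
    moreover have "inj_on ?g ?V" by (auto simp: inj_on_def doubleton_eq_iff)
    ultimately show ?thesis by (simp only: card_image)
  qed
  also have "\<dots> = card (?f ` ?H \<union> ?g ` ?V)"
  proof (rule card_Un_disjoint[symmetric])
    show "finite (?f ` ?H)" "finite (?g ` ?V)" using sub fin by (blast intro: finite_subset)+
    show "?f ` ?H \<inter> ?g ` ?V = {}" by (auto simp: doubleton_eq_iff)
  qed
  also have "\<dots> \<le> card {t \<in> P. is_dimer t}"
    by (rule card_mono[OF fin Un_least[OF sub]])
  finally show ?thesis unfolding edge_count_def using H V by simp
qed

text \<open>The transpose reduces the case of more rows than columns to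
  \<open>edge_count_ge\<close>, which is why the larger side appears.\<close>

lemma edge_count_ge_max:
  assumes t: "tatami_edges 0 (int c) 0 (int r) R D" and "1 \<le> r" "1 \<le> c"
  shows "int r * int c - int (max r c) - 1 \<le> 2 * edge_count 0 (int c) 0 (int r) R D"
proof (cases "r \<le> c")
  case True
  then show ?thesis using edge_count_ge[OF t, of r c] assms by (simp add: algebra_simps)
next
  case False
  then show ?thesis
    using edge_count_ge[OF tatami_edges_transpose[OF t], of c r] assms
    unfolding edge_count_transpose[where R = R and D = D] by (simp add: algebra_simps)
qed

theorem theorem1:
  fixes r c m :: nat
  assumes "r \<ge> 1" and "c \<ge> 1" and "T r c m > 0"
  shows "m mod 2 = (r * c) mod 2 \<and> m \<le> max (r + 1) (c + 1)"
proof -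
  have "{P. is_tatami r c P \<and> num_monomers P = m} \<noteq> {}"
    using assms(3) unfolding T_def by (metis card.empty less_numeral_extra(3))
  then obtain P where P: "is_tatami r c P" "num_monomers P = m" by blast
  then have til: "is_tiling r c P" unfolding is_tatami_def by blast
  define d where "d = card {t \<in> P. is_dimer t}"
  have count: "m + 2 * d = r * c" using num_monomers_add_dimers[OF til] P d_def by simp
  have "int r * int c - int (max r c) - 1 \<le> 2 * int d"
    using edge_count_ge_max[OF tatami_edges_of_tiling[OF P(1)]] edge_count_le_dimers[OF til] assms
    unfolding d_def by fastforce
  moreover have "int m + 2 * int d = int r * int c" using count by (metis of_nat_add of_nat_mult of_nat_numeral)
  ultimately have "int m \<le> int (max r c) + 1" by linarith
  then have "m \<le> max (r + 1) (c + 1)" by auto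
  moreover have "m mod 2 = (r * c) mod 2" using count by (metis mod_mult_self2)
  ultimately show ?thesis by blast
qed

end
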